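(* In the setting described in the context, let $p$ be the unique nonzero value for which the procedure returns $p_n=p$. After the procedure, delete the two parallel edges of conductances $p_n=p$ and $-p$ joining $1$ and $n'$. The resulting network is again of the form $N(2)$, with the new vertices $v_k$ in place of $M_k$ (for each $k$, $v_{k-1}$ is joined to $k,k-1,(k-1)',(k-2)'$), and its conductances are: edge $k$–$v_{k-1}$ has conductance $c'_k=\dfrac{\tau_k}{c_k\kappa_k}$; edge $v_{k-1}$–$(k-1)'$ has conductance $a'_k=\dfrac{\tau_k}{a_k\kappa_k}$; edge $k$–$v_k$ has conductance $d'_k=\dfrac{\tau_{k+1}}{d_k\kappa_k}$; edge $v_k$–$(k-1)'$ has conductance $b'_k=\dfrac{\tau_{k+1}}{b_k\kappa_k}$.
   Context: The network $N(2)$ (embedded in a cylinder): boundary vertices $1,\dots,n$ on the left boundary circle and $1',\dots,n'$ on the right, interior vertices $M_1,\dots,M_n$, indices modulo $n$. Edges and conductances: $k$–$M_{k-1}$: $a_k$; $k$–$M_k$: $b_k$; $M_{k-1}$–$(k-1)'$: $c_k$; $M_k$–$(k-1)'$: $d_k$. A $\Delta$–$Y$ move replaces a triangle $u,v,w$ with conductances $A$ on $vw$, $B$ on $uw$, $C$ on $uv$ by a new vertex $x$ joined to $u,v,w$ with conductances $(AB+AC+BC)/A,(AB+AC+BC)/B,(AB+AC+BC)/C$; a $Y$–$\Delta$ move is its inverse: a degree-3 interior vertex joined to $u,v,w$ with conductances $\alpha,\beta,\gamma$ is replaced by a triangle with conductance $\beta\gamma/(\alpha+\beta+\gamma)$ on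 $vw$, etc. Procedure: add an edge $e_0$ of conductance $p_0=p$ joining $1$ and $n'$, plus a parallel edge of conductance $-p$ (never touched). For $t=0,\dots,n-1$ with $k=1-t$: the edge $e_t$ (conductance $p_t$) joining $k$ and $(k-1)'$ forms a triangle with the edges $k$–$M_{k-1}$, $M_{k-1}$–$(k-1)'$; apply $\Delta$–$Y$ to it, creating a new vertex $v_{k-1}$; then apply $Y$–$\Delta$ at $M_{k-1}$ (now of degree 3, with neighbours $v_{k-1},k-1,(k-2)'$), and let $e_{t+1}$, of conductance $p_{t+1}$, be the new edge joining $k-1$ and $(k-2)'$. There is a unique nonzero $p$ with $p_n=p$ (conductances treated as indeterminates). Define, with all indices mod $n$ and empty products equal to $1$: $\tau_i=\sum_{j=0}^{n-1}\Big((a_{i+j}+c_{i+j})\prod_{k=i}^{i+j-1}(a_kc_k)\prod_{k=i+j}^{i+n-1}(b_kd_k)+(b_{i+j}+d_{i+j})\prod_{k=i}^{i+j}(a_kc_k)\prod_{k=i+j+1}^{i+n-1}(b_kd_k)\Big)$, $\kappa_i=(a_i+c_i)\prod_{k=i+1}^{i+n-1}(a_kc_k)+(b_i+d_i)\prod_{k=i+1}^{i+n-1}(b_kd_k)+\sum_{j=1}^{n-1}\Big((a_{i+j}+c_{i+j})\prod_{k=i+1}^{i+j-1}(a_kc_k)\prod_{k=i+j}^{i+n-1}(b_kd_k)+(b_{i+j}+d_{i+j})\prod_{k=i+1}^{i+j}(a_kc_k)\prod_{k=i+j+1}^{i+n-1}(b_kd_k)\Big)$. *)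

theory Defs
  imports
    "HOL-Library.Multiset"
    "HOL-Library.Poly_Mapping"
    "HOL-Computational_Algebra.Fraction_Field"
begin

text \<open>
  Rational functions over \<open>'k\<close> in countably many indeterminates. A polynomial is a finitely
  supported map from monomials to coefficients, a monomial a finitely supported map from
  indeterminates (numbered by \<open>nat\<close>) to exponents.
\<close>

type_synonym 'k ratfun = "((nat \<Rightarrow>\<^sub>0 nat) \<Rightarrow>\<^sub>0 'k) fract"

definition indet :: "nat \<Rightarrow> 'k::field ratfun" where
  "indet i = Fract (Poly_Mapping.single (Poly_Mapping.single i 1) 1) 1"

text \<open>
  Four families of \<open>n\<close> indeterminates, indexed modulo \<open>n\<close>; the numbers \<open>4 * m + r\<close> with
  \<open>m < n\<close> and \<open>r < 4\<close> are pairwise distinct, so the \<open>4 * n\<close> conductances are distinct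
  indeterminates.
\<close>

definition indet_family :: "nat \<Rightarrow> nat \<Rightarrow> int \<Rightarrow> 'k::field ratfun" where
  "indet_family n r k = indet (4 * nat (k mod int n) + r)"

definition cond_a :: "nat \<Rightarrow> int \<Rightarrow> 'k::field ratfun" where "cond_a n = indet_family n 0"
definition cond_b :: "nat \<Rightarrow> int \<Rightarrow> 'k::field ratfun" where "cond_b n = indet_family n 1"
definition cond_c :: "nat \<Rightarrow> int \<Rightarrow> 'k::field ratfun" where "cond_c n = indet_family n 2"
definition cond_d :: "nat \<Rightarrow> int \<Rightarrow> 'k::field ratfun" where "cond_d n = indet_family n 3"

text \<open>
  An edge is its set of endpoints together with its conductance; edges form a multiset, so
  parallel edges (also of equal conductance) are allowed.
\<close>

type_synonym ('v, 'f) edge = "'v set \<times> 'f"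

record ('v, 'f) network =
  boundary :: "'v set"
  interior :: "'v set"
  edges :: "('v, 'f) edge multiset"

text \<open>
  The moves require nonzero conductances before and after. On such networks all quotients below
  are meaningful and the two moves are inverse to each other.
\<close>

definition delta_wye ::
  "'v \<Rightarrow> 'v \<Rightarrow> 'v \<Rightarrow> 'v \<Rightarrow> 'f::field \<Rightarrow> 'f \<Rightarrow> 'f \<Rightarrow> ('v, 'f) network \<Rightarrow> ('v, 'f) network \<Rightarrow> bool"
where
  "delta_wye x u v w A B C N N' \<longleftrightarrow>
     distinct [u, v, w] \<and> x \<notin> boundary N \<union> interior N \<and>
     A \<noteq> 0 \<and> B \<noteq> 0 \<and> C \<noteq> 0 \<and> A * B + A * C + B * C \<noteq> 0 \<and>
     {#({v, w}, A), ({u, w}, B), ({u, v}, C)#} \<subseteq># edges N \<and>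
     N' = N\<lparr>interior := insert x (interior N),
            edges := edges N - {#({v, w}, A), ({u, w}, B), ({u, v}, C)#}
              + {#({x, u}, (A * B + A * C + B * C) / A),
                  ({x, v}, (A * B + A * C + B * C) / B),
                  ({x, w}, (A * B + A * C + B * C) / C)#}\<rparr>"

definition wye_delta ::
  "'v \<Rightarrow> 'v \<Rightarrow> 'v \<Rightarrow> 'v \<Rightarrow> 'f::field \<Rightarrow> 'f \<Rightarrow> 'f \<Rightarrow> ('v, 'f) network \<Rightarrow> ('v, 'f) network \<Rightarrow> bool"
where
  "wye_delta x u v w \<alpha> \<beta> \<gamma> N N' \<longleftrightarrow>
     distinct [x, u, v, w] \<and> x \<in> interior N \<and>
     \<alpha> \<noteq> 0 \<and> \<beta> \<noteq> 0 \<and> \<gamma> \<noteq> 0 \<and> \<alpha> + \<beta> + \<gamma> \<noteq> 0 \<and>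
     filter_mset (\<lambda>e. x \<in> fst e) (edges N) = {#({x, u}, \<alpha>), ({x, v}, \<beta>), ({x, w}, \<gamma>)#} \<and>
     N' = N\<lparr>interior := interior N - {x},
            edges := edges N - {#({x, u}, \<alpha>), ({x, v}, \<beta>), ({x, w}, \<gamma>)#}
              + {#({v, w}, \<beta> * \<gamma> / (\<alpha> + \<beta> + \<gamma>)),
                  ({u, w}, \<alpha> * \<gamma> / (\<alpha> + \<beta> + \<gamma>)),
                  ({u, v}, \<alpha> * \<beta> / (\<alpha> + \<beta> + \<gamma>))#}\<rparr>"

text \<open>
  \<open>Lft k\<close>, \<open>Rgt k\<close>, \<open>Mid k\<close>, \<open>New k\<close> are the vertices written \<open>k\<close>, \<open>k'\<close>, \<open>M_k\<close>, \<open>v_k\<close>.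
  Indices modulo \<open>n\<close> are represented by \<open>0, ..., n - 1\<close>; the functions \<open>lft\<close>, \<open>rgt\<close>,
  \<open>mid\<close>, \<open>new\<close> reduce an arbitrary integer index.
\<close>

datatype vertex = Lft int | Rgt int | Mid int | New int

definition lft :: "nat \<Rightarrow> int \<Rightarrow> vertex" where "lft n k = Lft (k mod int n)"
definition rgt :: "nat \<Rightarrow> int \<Rightarrow> vertex" where "rgt n k = Rgt (k mod int n)"
definition mid :: "nat \<Rightarrow> int \<Rightarrow> vertex" where "mid n k = Mid (k mod int n)"
definition new :: "nat \<Rightarrow> int \<Rightarrow> vertex" where "new n k = New (k mod int n)"

text \<open>
  The network \<open>N(2)\<close> with interior vertices \<open>m 1, ..., m n\<close>.
\<close>

definition N2 ::
  "nat \<Rightarrow> (int \<Rightarrow> vertex) \<Rightarrow> (int \<Rightarrow> 'f) \<Rightarrow> (int \<Rightarrow> 'f) \<Rightarrow> (int \<Rightarrow> 'f) \<Rightarrow> (int \<Rightarrow> 'f)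
     \<Rightarrow> (vertex, 'f) network"
where
  "N2 n m a b c d =
     \<lparr>boundary = lft n ` {1..int n} \<union> rgt n ` {1..int n},
      interior = m ` {1..int n},
      edges = (\<Sum>k\<in>{1..int n}.
        {#({lft n k, m (k - 1)}, a k), ({lft n k, m k}, b k),
          ({m (k - 1), rgt n (k - 1)}, c k), ({m k, rgt n (k - 1)}, d k)#})\<rparr>"

text \<open>
  \<open>procedure n a b c d p t N q\<close>: the procedure started with \<open>p\<^sub>0 = p\<close> has, after \<open>t\<close> of its
  \<open>n\<close> rounds, produced the network \<open>N\<close>, and \<open>p\<^sub>t = q\<close>. It relates nothing to a value \<open>p\<close>
  for which some move is not applicable.
\<close>

inductive procedure ::
  "nat \<Rightarrow> (int \<Rightarrow> 'f::field) \<Rightarrow> (int \<Rightarrow> 'f) \<Rightarrow> (int \<Rightarrow> 'f) \<Rightarrow> (int \<Rightarrow> 'f)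
     \<Rightarrow> 'f \<Rightarrow> nat \<Rightarrow> (vertex, 'f) network \<Rightarrow> 'f \<Rightarrow> bool"
  for n a b c d p
where
  start:
    "N = N2 n (mid n) a b c d \<Longrightarrow>
     procedure n a b c d p 0
       (N\<lparr>edges := edges N + {#({lft n 1, rgt n (int n)}, p), ({lft n 1, rgt n (int n)}, - p)#}\<rparr>) p"
| round:
    "procedure n a b c d p t N q \<Longrightarrow> t < n \<Longrightarrow> k = 1 - int t \<Longrightarrow>
     delta_wye (new n (k - 1)) (lft n k) (rgt n (k - 1)) (mid n (k - 1)) (c k) (a k) q N N' \<Longrightarrow>
     wye_delta (mid n (k - 1)) (new n (k - 1)) (lft n (k - 1)) (rgt n (k - 2)) \<alpha> \<beta> \<gamma> N' N'' \<Longrightarrow>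
     procedure n a b c d p (Suc t) N'' (\<beta> * \<gamma> / (\<alpha> + \<beta> + \<gamma>))"

definition tau ::
  "nat \<Rightarrow> (int \<Rightarrow> 'f::field) \<Rightarrow> (int \<Rightarrow> 'f) \<Rightarrow> (int \<Rightarrow> 'f) \<Rightarrow> (int \<Rightarrow> 'f) \<Rightarrow> int \<Rightarrow> 'f"
where
  "tau n a b c d i =
     (\<Sum>j\<in>{0..int n - 1}.
        (a (i + j) + c (i + j)) * (\<Prod>k\<in>{i..i + j - 1}. a k * c k)
          * (\<Prod>k\<in>{i + j..i + int n - 1}. b k * d k)
      + (b (i + j) + d (i + j)) * (\<Prod>k\<in>{i..i + j}. a k * c k)
          * (\<Prod>k\<in>{i + j + 1..i + int n - 1}. b k * d k))"

definition kappa ::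
  "nat \<Rightarrow> (int \<Rightarrow> 'f::field) \<Rightarrow> (int \<Rightarrow> 'f) \<Rightarrow> (int \<Rightarrow> 'f) \<Rightarrow> (int \<Rightarrow> 'f) \<Rightarrow> int \<Rightarrow> 'f"
where
  "kappa n a b c d i =
     (a i + c i) * (\<Prod>k\<in>{i + 1..i + int n - 1}. a k * c k)
   + (b i + d i) * (\<Prod>k\<in>{i + 1..i + int n - 1}. b k * d k)
   + (\<Sum>j\<in>{1..int n - 1}.
        (a (i + j) + c (i + j)) * (\<Prod>k\<in>{i + 1..i + j - 1}. a k * c k)
          * (\<Prod>k\<in>{i + j..i + int n - 1}. b k * d k)
      + (b (i + j) + d (i + j)) * (\<Prod>k\<in>{i + 1..i + j}. a k * c k)
          * (\<Prod>k\<in>{i + j + 1..i + int n - 1}. b k * d k))"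

end

theory Submission
  imports Defs
begin

text \<open>
  In terms of \<open>x\<^sub>t = 1 / p\<^sub>t\<close> round \<open>t\<close>, with \<open>k = 1 - t\<close>, is the affine map
  \<open>x \<mapsto> (a\<^sub>k c\<^sub>k x + a\<^sub>k + c\<^sub>k + b\<^bsub>k-1\<^esub> + d\<^bsub>k-1\<^esub>) / (b\<^bsub>k-1\<^esub> d\<^bsub>k-1\<^esub>)\<close>. The composite of
  the \<open>n\<close> rounds is affine with slope \<open>\<Prod> a\<^sub>k c\<^sub>k / \<Prod> b\<^sub>k d\<^sub>k \<noteq> 1\<close>, hence has exactly one fixed point.
  With \<open>g = \<Prod> b\<^sub>k d\<^sub>k - \<Prod> a\<^sub>k c\<^sub>k\<close>, the identities \<open>\<tau>\<^sub>k = a\<^sub>k c\<^sub>k \<kappa>\<^sub>k + g (a\<^sub>k + c\<^sub>k)\<close> and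
  \<open>\<tau>\<^bsub>k+1\<^esub> + g (b\<^sub>k + d\<^sub>k) = b\<^sub>k d\<^sub>k \<kappa>\<^sub>k\<close> show that on the periodic orbit \<open>x\<^sub>t = \<kappa>\<^sub>k / g\<close>, and that
  the new edge \<open>M\<^bsub>k-1\<^esub> v\<^bsub>k-1\<^esub>\<close> has conductance \<open>\<tau>\<^sub>k / g\<close>; all other conductances are read
  off from these two. The moves are applicable because \<open>g\<close>, all \<open>\<tau>\<^sub>k\<close> and all \<open>\<kappa>\<^sub>k\<close> are nonzero
  polynomials over every field: each takes the value \<open>1\<close> at a suitable point with coordinates in
  \<open>{0, 1}\<close>.
\<close>

subsection \<open>Specialization of polynomials at points with coordinates 0 and 1\<close>

text \<open>Linear extension of the monomial values \<open>w\<close>; it is multiplicative as soon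
  as \<open>w\<close> is.\<close>

definition evaluate :: "('m \<Rightarrow> 'r) \<Rightarrow> ('m \<Rightarrow>\<^sub>0 'r) \<Rightarrow> 'r::comm_ring_1" where
  "evaluate w p = (\<Sum>m\<in>Poly_Mapping.keys p. Poly_Mapping.lookup p m * w m)"

lemma evaluate_zero [simp]: "evaluate w 0 = 0"
  by (simp add: evaluate_def)

lemma evaluate_single [simp]: "evaluate w (Poly_Mapping.single m x) = x * w m"
  by (cases "x = 0") (simp_all add: evaluate_def)

lemma evaluate_superset:
  assumes "finite S" "Poly_Mapping.keys p \<subseteq> S"
  shows "evaluate w p = (\<Sum>m\<in>S. Poly_Mapping.lookup p m * w m)"
  unfolding evaluate_def using assms
  by (intro sum.mono_neutral_left) (auto simp: in_keys_iff)

lemma evaluate_add: "evaluate w (p + q) = evaluate w p + evaluate w q"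
proof -
  let ?S = "Poly_Mapping.keys p \<union> Poly_Mapping.keys q"
  have "Poly_Mapping.keys (p + q) \<subseteq> ?S"
    by (rule keys_add)
  then have "evaluate w (p + q) = (\<Sum>m\<in>?S. Poly_Mapping.lookup (p + q) m * w m)"
    by (intro evaluate_superset) auto
  also have "\<dots> = (\<Sum>m\<in>?S. Poly_Mapping.lookup p m * w m) + (\<Sum>m\<in>?S. Poly_Mapping.lookup q m * w m)"
    by (simp add: lookup_add distrib_right sum.distrib)
  also have "\<dots> = evaluate w p + evaluate w q"
    by (simp add: evaluate_superset[of ?S])
  finally show ?thesis .
qed

lemma poly_mapping_plus_induct [case_names zero plus]:
  assumes "P 0" "\<And>m x p. P p \<Longrightarrow> P (Poly_Mapping.single m x + p)"
  shows "P (p :: 'm \<Rightarrow>\<^sub>0 'r::comm_monoid_add)"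
proof (induction p rule: update_induct)
  case const
  show ?case by (rule assms)
next
  case (update p m x)
  then have "Poly_Mapping.update m x p = Poly_Mapping.single m x + p"
    by (intro poly_mapping_eqI)
      (auto simp: lookup_update lookup_add lookup_single not_in_keys_iff_lookup_eq_zero when_def)
  with assms(2)[OF update(3)] show ?case by simp
qed

text \<open>Both sides are additive in \<open>p\<close> and in \<open>q\<close>, which leaves two
  single terms.\<close>

lemma evaluate_mult:
  fixes p q :: "('m::monoid_add) \<Rightarrow>\<^sub>0 'r::comm_ring_1"
  assumes w: "\<And>m m'. w (m + m') = w m * w m'"
  shows "evaluate w (p * q) = evaluate w p * evaluate w q"
proof (induction p rule: poly_mapping_plus_induct)
  case (plus m x p)
  have "evaluate w (Poly_Mapping.single m x * q) = x * w m * evaluate w q"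
    by (induction q rule: poly_mapping_plus_induct)
      (simp_all add: distrib_left evaluate_add mult_single w mult_ac)
  with plus show ?case
    by (simp add: distrib_right evaluate_add)
qed simp

text \<open>Monomials at the point with coordinates \<open>0\<close> in \<open>Z\<close> and \<open>1\<close> elsewhere.\<close>

definition zero_one :: "nat set \<Rightarrow> (nat \<Rightarrow>\<^sub>0 nat) \<Rightarrow> 'k::field" where
  "zero_one Z m = (if Poly_Mapping.keys m \<inter> Z = {} then 1 else 0)"

lemma zero_one_add: "zero_one Z (m + m') = zero_one Z m * zero_one Z m'"
proof -
  have "Poly_Mapping.keys (m + m') = Poly_Mapping.keys m \<union> Poly_Mapping.keys m'"
    by (auto simp: in_keys_iff lookup_add)
  then show ?thesis
    by (auto simp: zero_one_def)
qed

text \<open>Only polynomials receive a value, since a denominator may vanish at the point; hence a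
  relation instead of a function.\<close>

definition specializes :: "nat set \<Rightarrow> 'k::field ratfun \<Rightarrow> 'k \<Rightarrow> bool" where
  "specializes Z x v \<longleftrightarrow> (\<exists>p. x = Fract p 1 \<and> evaluate (zero_one Z) p = v)"

lemma specializes_nonzero:
  assumes "specializes Z x v" "v \<noteq> 0"
  shows "x \<noteq> 0"
  using assms by (auto simp: specializes_def eq_fract Zero_fract_def)

lemma specializes_add:
  assumes "specializes Z x u" "specializes Z y v"
  shows "specializes Z (x + y) (u + v)"
  using assms unfolding specializes_def
  by (metis (no_types, lifting) add_fract evaluate_add mult.right_neutral one_neq_zero)

lemma specializes_mult:
  assumes "specializes Z x u" "specializes Z y v"
  shows "specializes Z (x * y) (u * v)"
  using assms unfolding specializes_def
  by (metis (no_types, lifting) mult_fract evaluate_mult[of "zero_one Z", OF zero_one_add] mult.right_neutral)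

lemma specializes_minus:
  assumes "specializes Z x u"
  shows "specializes Z (- x) (- u)"
proof -
  obtain p where p: "x = Fract p 1" "evaluate (zero_one Z) p = u"
    using assms by (auto simp: specializes_def)
  have "evaluate (zero_one Z) (- p) + evaluate (zero_one Z) p = 0"
    by (simp flip: evaluate_add)
  with p show ?thesis
    unfolding specializes_def by (intro exI[of _ "- p"]) (simp add: eq_neg_iff_add_eq_0)
qed

lemma specializes_0: "specializes Z 0 0"
  by (auto simp: specializes_def Zero_fract_def intro!: exI[of _ 0])

lemma specializes_1: "specializes Z 1 1"
  by (auto simp: specializes_def One_fract_def zero_one_def simp flip: single_one intro!: exI[of _ 1])

lemma specializes_sum:
  "(\<And>i. i \<in> I \<Longrightarrow> specializes Z (x i) (u i)) \<Longrightarrow> specializes Z (sum x I) (sum u I)"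
  by (induction I rule: infinite_finite_induct) (auto intro: specializes_add specializes_0)

lemma specializes_prod:
  "(\<And>i. i \<in> I \<Longrightarrow> specializes Z (x i) (u i)) \<Longrightarrow> specializes Z (prod x I) (prod u I)"
  by (induction I rule: infinite_finite_induct) (auto intro: specializes_mult specializes_1)

lemma specializes_indet: "specializes Z (indet i) (if i \<in> Z then 0 else 1)"
  unfolding specializes_def indet_def
  by (intro exI conjI, rule refl, subst evaluate_single) (simp add: zero_one_def)

lemmas specializes_intros = specializes_add specializes_mult specializes_sum specializes_prod

section \<open>Nonvanishing at indeterminate conductances\<close>

lemma specializes_tau:
  assumes "\<And>k. specializes Z (a k) (a0 k)" "\<And>k. specializes Z (b k) (b0 k)"
    "\<And>k. specializes Z (c k) (c0 k)" "\<And>k. specializes Z (d k) (d0 k)"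
  shows "specializes Z (tau n a b c d i) (tau n a0 b0 c0 d0 i)"
  unfolding tau_def by (intro specializes_intros assms)

lemma specializes_kappa:
  assumes "\<And>k. specializes Z (a k) (a0 k)" "\<And>k. specializes Z (b k) (b0 k)"
    "\<And>k. specializes Z (c k) (c0 k)" "\<And>k. specializes Z (d k) (d0 k)"
  shows "specializes Z (kappa n a b c d i) (kappa n a0 b0 c0 d0 i)"
  unfolding kappa_def by (intro specializes_intros assms)


text \<open>A pair \<open>(m, r)\<close> stands for the indeterminate with number \<open>4 * m + r\<close>.\<close>

definition zero_one_family :: "(nat \<times> nat) set \<Rightarrow> nat \<Rightarrow> nat \<Rightarrow> int \<Rightarrow> 'k::field" where
  "zero_one_family S n r k = (if (nat (k mod int n), r) \<in> S then 0 else 1)"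

lemma specializes_cond:
  fixes S :: "(nat \<times> nat) set"
  defines "Z \<equiv> {l. (l div 4, l mod 4) \<in> S}"
  shows "specializes Z (cond_a n k) (zero_one_family S n 0 k)"
    "specializes Z (cond_b n k) (zero_one_family S n 1 k)"
    "specializes Z (cond_c n k) (zero_one_family S n 2 k)"
    "specializes Z (cond_d n k) (zero_one_family S n 3 k)"
proof -
  have *: "specializes Z (indet_family n r k) (zero_one_family S n r k)" if "r < 4" for r
    using specializes_indet[of Z "4 * nat (k mod int n) + r"] that
    by (simp add: Z_def indet_family_def zero_one_family_def)
  show "specializes Z (cond_a n k) (zero_one_family S n 0 k)"
    "specializes Z (cond_b n k) (zero_one_family S n 1 k)"
    "specializes Z (cond_c n k) (zero_one_family S n 2 k)"
    "specializes Z (cond_d n k) (zero_one_family S n 3 k)"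
    unfolding cond_a_def cond_b_def cond_c_def cond_d_def by (rule *, simp)+
qed

lemma indet_nonzero: "indet i \<noteq> (0 :: 'k::field ratfun)"
  by (rule specializes_nonzero[OF specializes_indet[of "{}"]]) simp

lemma cond_nonzero:
  "cond_a n k \<noteq> (0 :: 'k::field ratfun)" "cond_b n k \<noteq> (0 :: 'k::field ratfun)"
  "cond_c n k \<noteq> (0 :: 'k::field ratfun)" "cond_d n k \<noteq> (0 :: 'k::field ratfun)"
  by (simp_all add: cond_a_def cond_b_def cond_c_def cond_d_def indet_family_def indet_nonzero)

text \<open>At \<open>a = 0\<close>, \<open>b = c = d = 1\<close> only the first summand of \<open>tau\<close> survives.\<close>

lemma tau_cond_nonzero:
  assumes "n \<ge> 1"
  shows "tau n (cond_a n) (cond_b n) (cond_c n) (cond_d n) i \<noteq> (0 :: 'k::field ratfun)"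
proof -
  let ?S = "UNIV \<times> {0} :: (nat \<times> nat) set"
  let ?f = "zero_one_family ?S n :: nat \<Rightarrow> int \<Rightarrow> 'k"
  have f: "?f 0 = (\<lambda>k. 0)" "?f 1 = (\<lambda>k. 1)" "?f 2 = (\<lambda>k. 1)" "?f 3 = (\<lambda>k. 1)"
    by (auto simp: zero_one_family_def)
  have "tau n (?f 0) (?f 1) (?f 2) (?f 3) i = (\<Sum>j\<in>{0..int n - 1}. if j = 0 then 1 else 0)"
    unfolding tau_def f by (intro sum.cong refl) (auto simp: power_0_left)
  then have "tau n (?f 0) (?f 1) (?f 2) (?f 3) i = 1"
    using assms by simp
  moreover have "specializes {l. (l div 4, l mod 4) \<in> ?S}
      (tau n (cond_a n) (cond_b n) (cond_c n) (cond_d n) i) (tau n (?f 0) (?f 1) (?f 2) (?f 3) i)"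
    by (intro specializes_tau specializes_cond)
  ultimately show ?thesis
    by (intro specializes_nonzero) auto
qed

text \<open>At \<open>a = c = b\<^sub>i = 0\<close> and \<open>1\<close> elsewhere only \<open>d\<^sub>i \<Prod> b\<^sub>k d\<^sub>k\<close> survives. The value \<open>b\<^sub>i = 1\<close>
  would give \<open>2\<close>, which vanishes in characteristic \<open>2\<close>.\<close>

lemma kappa_cond_nonzero:
  assumes "n \<ge> 1"
  shows "kappa n (cond_a n) (cond_b n) (cond_c n) (cond_d n) i \<noteq> (0 :: 'k::field ratfun)"
proof -
  let ?S = "UNIV \<times> {0, 2} \<union> {(nat (i mod int n), 1)} :: (nat \<times> nat) set"
  let ?f = "zero_one_family ?S n :: nat \<Rightarrow> int \<Rightarrow> 'k"
  have f: "?f 0 = (\<lambda>k. 0)" "?f 2 = (\<lambda>k. 0)" "?f 3 = (\<lambda>k. 1)" "?f 1 i = 0"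
    by (auto simp: zero_one_family_def)
  \<comment> \<open>The product of the other \<open>b\<close> avoids the zero at \<open>i\<close>:
    none of these \<open>n - 1\<close> indices is congruent to \<open>i\<close>.\<close>
  have f1: "?f 1 k = 1" if "k \<in> {i + 1..i + int n - 1}" for k
  proof -
    have "\<not> int n dvd k - i"
      using that zdvd_not_zless[of "k - i" "int n"] by auto
    then have "k mod int n \<noteq> i mod int n"
      using mod_eq_dvd_iff by blast
    then show ?thesis
      using assms by (auto simp: zero_one_family_def nat_eq_iff)
  qed
  have "kappa n (?f 0) (?f 1) (?f 2) (?f 3) i = 1"
    unfolding kappa_def f using f1 by (simp add: power_0_left)
  moreover have "specializes {l. (l div 4, l mod 4) \<in> ?S}
      (kappa n (cond_a n) (cond_b n) (cond_c n) (cond_d n) i) (kappa n (?f 0) (?f 1) (?f 2) (?f 3) i)"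
    by (intro specializes_kappa specializes_cond)
  ultimately show ?thesis
    by (intro specializes_nonzero) auto
qed

text \<open>At \<open>a = 0\<close> and \<open>1\<close> elsewhere the difference is
  \<open>1 - 0\<close>; the second product is nonempty because \<open>n \<ge> 1\<close>.\<close>

lemma prod_cond_neq:
  assumes "n \<ge> 1"
  shows "(\<Prod>k\<in>{1..int n}. cond_b n k * cond_d n k) - (\<Prod>k\<in>{1..int n}. cond_a n k * cond_c n k)
    \<noteq> (0 :: 'k::field ratfun)"
proof -
  let ?S = "UNIV \<times> {0} :: (nat \<times> nat) set"
  let ?f = "zero_one_family ?S n :: nat \<Rightarrow> int \<Rightarrow> 'k"
  have f: "?f 0 = (\<lambda>k. 0)" "?f 1 = (\<lambda>k. 1)" "?f 2 = (\<lambda>k. 1)" "?f 3 = (\<lambda>k. 1)"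
    by (auto simp: zero_one_family_def)
  have "specializes {l. (l div 4, l mod 4) \<in> ?S}
     ((\<Prod>k\<in>{1..int n}. cond_b n k * cond_d n k) + - (\<Prod>k\<in>{1..int n}. cond_a n k * cond_c n k))
     ((\<Prod>k\<in>{1..int n}. ?f 1 k * ?f 3 k) + - (\<Prod>k\<in>{1..int n}. ?f 0 k * ?f 2 k))"
    by (intro specializes_intros specializes_minus specializes_cond)
  from specializes_nonzero[OF this] show ?thesis
    unfolding f using assms by (simp add: power_0_left)
qed

subsection \<open>Periodic families and edges of N(2)\<close>

text \<open>One step of the window trades \<open>g i\<close> for \<open>g (i + int n)\<close>. The
  generality serves both sums of edge multisets and products of conductances.\<close>

lemma (in comm_monoid_set) periodic_window:
  fixes g :: "int \<Rightarrow> 'a"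
  assumes "\<And>k. g (k + int n) = g k"
  shows "F g {i..<i + int n} = F g {j..<j + int n}"
proof -
  have step: "F g {i..<i + int n} = F g {i + 1..<i + 1 + int n}" for i
  proof (cases "n = 0")
    case False
    then have "{i..<i + int n} = insert i {i + 1..<i + int n}"
      "{i + 1..<i + 1 + int n} = insert (i + int n) {i + 1..<i + int n}"
      by auto
    with assms show ?thesis by simp
  qed simp
  show ?thesis
  proof (induction i rule: int_induct[where k = j])
    case (step1 i)
    then show ?case using step[of i] by simp
  next
    case (step2 i)
    then show ?case using step[of "i - 1"] by simp
  qed simp
qed

lemma prod_shift_int:
  "(\<Prod>k\<in>{x + t..y + t}. f k) = (\<Prod>k\<in>{x..y::int}. f (k + t))"
  by (rule prod.reindex_bij_witness[of _ "\<lambda>k. k + t" "\<lambda>k. k - t"]) auto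

lemma tau_shift:
  assumes "\<And>k. a (k + t) = a k" "\<And>k. b (k + t) = b k" "\<And>k. c (k + t) = c k" "\<And>k. d (k + t) = d k"
  shows "tau n a b c d (i + t) = tau n a b c d i"
proof -
  have "i + t + j = i + j + t" "i + j + t - 1 = i + j - 1 + t" "i + j + t + 1 = i + j + 1 + t" for j
    by simp_all
  then show ?thesis
    unfolding tau_def using assms by (simp only: prod_shift_int)
qed

lemma kappa_shift:
  assumes "\<And>k. a (k + t) = a k" "\<And>k. b (k + t) = b k" "\<And>k. c (k + t) = c k" "\<And>k. d (k + t) = d k"
  shows "kappa n a b c d (i + t) = kappa n a b c d i"
proof -
  have "i + t + j = i + j + t" "i + j + t - 1 = i + j - 1 + t" "i + j + t + 1 = i + j + 1 + t" for j
    by simp_all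
  then show ?thesis
    unfolding kappa_def using assms by (simp only: prod_shift_int)
qed

text \<open>Edges grouped by interior vertex, since one round replaces one such vertex;
  \<open>N2\<close> groups them by the index \<open>k\<close>.\<close>

definition star ::
  "nat \<Rightarrow> (int \<Rightarrow> vertex) \<Rightarrow> (int \<Rightarrow> 'f) \<Rightarrow> (int \<Rightarrow> 'f) \<Rightarrow> (int \<Rightarrow> 'f) \<Rightarrow> (int \<Rightarrow> 'f)
     \<Rightarrow> int \<Rightarrow> (vertex, 'f) edge multiset"
where
  "star n m a b c d j =
     {#({lft n (j + 1), m j}, a (j + 1)), ({lft n j, m j}, b j),
       ({m j, rgt n j}, c (j + 1)), ({m j, rgt n (j - 1)}, d j)#}"

lemma shift_labels [simp]:
  "lft n (k + int n) = lft n k" "rgt n (k + int n) = rgt n k"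
  "mid n (k + int n) = mid n k" "new n (k + int n) = new n k"
  by (simp_all add: lft_def rgt_def mid_def new_def)

lemma N2_edges_stars:
  fixes a b c d :: "int \<Rightarrow> 'f"
  assumes per: "\<And>k. m (k + int n) = m k" "\<And>k. a (k + int n) = a k" "\<And>k. b (k + int n) = b k"
    "\<And>k. c (k + int n) = c k" "\<And>k. d (k + int n) = d k"
  shows "edges (N2 n m a b c d) = (\<Sum>t<n. star n m a b c d (- int t))"
proof -
  define f where "f k = {#({lft n k, m (k - 1)}, a k), ({m (k - 1), rgt n (k - 1)}, c k)#}" for k
  define g where "g k = {#({lft n k, m k}, b k), ({m k, rgt n (k - 1)}, d k)#}" for k
  have sh: "k + int n - 1 = k - 1 + int n" for k
    by simp
  have f: "f (k + int n) = f k" and g: "g (k + int n) = g k" for k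
    unfolding f_def g_def by (simp_all only: sh per shift_labels)
  have "edges (N2 n m a b c d) = (\<Sum>k\<in>{1..int n}. f k + g k)"
    by (auto simp: N2_def f_def g_def intro!: sum.cong)
  also have "{1..int n} = {1..<1 + int n}"
    by auto
  \<comment> \<open>The two halves get different windows, so that both run over \<open>m 0\<close>,
    \<open>m (- 1)\<close>, ..., the order of the rounds.\<close>
  also have "(\<Sum>k\<in>\<dots>. f k + g k) = (\<Sum>k\<in>{2 - int n..<2 - int n + int n}. f k)
      + (\<Sum>k\<in>{1 - int n..<1 - int n + int n}. g k)"
    unfolding sum.distrib
    by (intro arg_cong2[of _ _ _ _ "(+)"] sum.periodic_window f g)
  also have "\<dots> = (\<Sum>t<n. f (1 - int t)) + (\<Sum>t<n. g (- int t))"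
    by (intro arg_cong2[of _ _ _ _ "(+)"] sum.reindex_bij_witness[of _ "\<lambda>t. 1 - int t" "\<lambda>k. nat (1 - k)"]
       sum.reindex_bij_witness[of _ "\<lambda>t. - int t" "\<lambda>k. nat (- k)"]) auto
  also have "\<dots> = (\<Sum>t<n. star n m a b c d (- int t))"
    by (auto simp: star_def f_def g_def add.commute simp flip: sum.distrib intro!: sum.cong)
  finally show ?thesis .
qed

lemma periodic_image:
  fixes f :: "int \<Rightarrow> 'v"
  assumes "\<And>k. f (k + int n) = f k"
  shows "f ` {1..int n} = (\<lambda>t. f (- int t)) ` {..<n}"
proof
  show "f ` {1..int n} \<subseteq> (\<lambda>t. f (- int t)) ` {..<n}"
  proof (rule image_subsetI)
    fix k :: int
    assume k: "k \<in> {1..int n}"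
    then have "f k = f (- int (nat (int n - k)))"
      using assms[of "k - int n"] by simp
    with k show "f k \<in> (\<lambda>t. f (- int t)) ` {..<n}"
      by (intro image_eqI[of _ _ "nat (int n - k)"]) auto
  qed
  show "(\<lambda>t. f (- int t)) ` {..<n} \<subseteq> f ` {1..int n}"
  proof (rule image_subsetI)
    fix t
    assume "t \<in> {..<n}"
    then show "f (- int t) \<in> f ` {1..int n}"
      using assms[of "- int t"] by (intro image_eqI[of _ _ "int n - int t"]) (auto simp: algebra_simps)
  qed
qed

lemma label_eq_iff:
  assumes "s < n" "t < n"
  shows "mid n (- int s) = mid n (- int t) \<longleftrightarrow> s = t" "new n (- int s) = new n (- int t) \<longleftrightarrow> s = t"
proof -
  have "s = t" if "(- int s) mod int n = (- int t) mod int n"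
  proof -
    have "int n dvd int t - int s"
      using that by (simp add: mod_eq_dvd_iff)
    with assms show ?thesis
      using dvd_imp_le_int[of "int t - int s" "int n"] by (cases "s = t") auto
  qed
  then show "mid n (- int s) = mid n (- int t) \<longleftrightarrow> s = t" "new n (- int s) = new n (- int t) \<longleftrightarrow> s = t"
    by (auto simp: mid_def new_def)
qed

text \<open>Each move involves one vertex of each kind, so its distinctness condition holds even for
  \<open>n = 1\<close>, where \<open>k\<close> and \<open>k - 1\<close> coincide.\<close>

lemma label_distinct [simp]:
  "lft n i \<noteq> rgt n j" "lft n i \<noteq> mid n j" "lft n i \<noteq> new n j"
  "rgt n i \<noteq> lft n j" "rgt n i \<noteq> mid n j" "rgt n i \<noteq> new n j"
  "mid n i \<noteq> lft n j" "mid n i \<noteq> rgt n j" "mid n i \<noteq> new n j"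
  "new n i \<noteq> lft n j" "new n i \<noteq> rgt n j" "new n i \<noteq> mid n j"
  by (simp_all add: lft_def rgt_def mid_def new_def)

text \<open>Filtering by each tag separates the values. With endpoint sets as tags, this makes the
  conductances of a Y-Delta move unique.\<close>

lemma tagged_mset_eq_iff:
  assumes "distinct [u, v, w]"
  shows "{#(u, x), (v, y), (w, z)#} = {#(u, x'), (v, y'), (w, z')#} \<longleftrightarrow> x = x' \<and> y = y' \<and> z = z'"
proof
  assume eq: "{#(u, x), (v, y), (w, z)#} = {#(u, x'), (v, y'), (w, z')#}"
  have "{#e \<in># {#(u, x), (v, y), (w, z)#}. fst e = r#} = {#e \<in># {#(u, x'), (v, y'), (w, z')#}. fst e = r#}" for r
    unfolding eq ..
  from this[of u] this[of v] this[of w] assms show "x = x' \<and> y = y' \<and> z = z'"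
    by auto
qed simp

subsection \<open>The rounds of the procedure\<close>

locale periodic_conductances =
  fixes n :: nat and a b c d :: "int \<Rightarrow> 'f::field"
  assumes n: "n \<ge> 1"
    and periodic: "\<And>k. a (k + int n) = a k" "\<And>k. b (k + int n) = b k"
      "\<And>k. c (k + int n) = c k" "\<And>k. d (k + int n) = d k"
    and nonzero: "\<And>k. a k \<noteq> 0" "\<And>k. b k \<noteq> 0" "\<And>k. c k \<noteq> 0" "\<And>k. d k \<noteq> 0"
begin

text \<open>The inverses \<open>x\<^sub>t = 1 / p\<^sub>t\<close>. If a move is not applicable, the values from there on are junk.\<close>

primrec resistance :: "'f \<Rightarrow> nat \<Rightarrow> 'f" where
  "resistance p 0 = 1 / p"
| "resistance p (Suc t) =
    (a (1 - int t) * c (1 - int t) * resistance p t + (a (1 - int t) + c (1 - int t))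
      + (b (- int t) + d (- int t))) / (b (- int t) * d (- int t))"

declare resistance.simps(2) [simp del]

text \<open>The conductance of the edge \<open>M\<^bsub>-t\<^esub> v\<^bsub>-t\<^esub>\<close>, which exists only between the two moves of round \<open>t\<close>.\<close>

definition spoke :: "'f \<Rightarrow> nat \<Rightarrow> 'f" where
  "spoke p t = a (1 - int t) * c (1 - int t) * resistance p t + (a (1 - int t) + c (1 - int t))"

text \<open>The left side is the total conductance at \<open>M_{-t}\<close> just before the Y-Delta
  move.\<close>

lemma spoke_add:
  "spoke p t + b (- int t) + d (- int t) = b (- int t) * d (- int t) * resistance p (Suc t)"
  using nonzero by (simp add: spoke_def resistance.simps)

text \<open>The first and third edge come from the Delta-Y move, the other two from the Y-Delta
  move.\<close>

definition new_star :: "'f \<Rightarrow> nat \<Rightarrow> (vertex, 'f) edge multiset" where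
  "new_star p t =
     {#({lft n (1 - int t), new n (- int t)}, spoke p t / (c (1 - int t) * resistance p t)),
       ({lft n (- int t), new n (- int t)}, spoke p t / (d (- int t) * resistance p (Suc t))),
       ({new n (- int t), rgt n (- int t)}, spoke p t / (a (1 - int t) * resistance p t)),
       ({new n (- int t), rgt n (- int t - 1)}, spoke p t / (b (- int t) * resistance p (Suc t)))#}"

definition fixed_edge :: "'f \<Rightarrow> (vertex, 'f) edge" where
  "fixed_edge p = ({lft n 1, rgt n (int n)}, - p)"

text \<open>The network claimed after \<open>t\<close> rounds: \<open>s < t\<close> counts finished
  vertices, \<open>s \<ge> t\<close> those still to be replaced.\<close>

definition stage :: "'f \<Rightarrow> nat \<Rightarrow> (vertex, 'f) network" where
  "stage p t =
     \<lparr>boundary = lft n ` {1..int n} \<union> rgt n ` {1..int n},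
      interior = (\<lambda>s. new n (- int s)) ` {..<t} \<union> (\<lambda>s. mid n (- int s)) ` {t..<n},
      edges = {#({lft n (1 - int t), rgt n (- int t)}, 1 / resistance p t), fixed_edge p#}
        + (\<Sum>s<t. new_star p s) + (\<Sum>s\<in>{t..<n}. star n (mid n) a b c d (- int s))\<rparr>"

lemma stage_0:
  "stage p 0 = (let N = N2 n (mid n) a b c d in
     N\<lparr>edges := edges N + {#({lft n 1, rgt n (int n)}, p), ({lft n 1, rgt n (int n)}, - p)#}\<rparr>)"
proof -
  have "rgt n (int n) = rgt n 0"
    by (simp add: rgt_def)
  moreover have "edges (N2 n (mid n) a b c d) = (\<Sum>s<n. star n (mid n) a b c d (- int s))"
    by (rule N2_edges_stars) (simp_all add: periodic)
  moreover have "mid n ` {1..int n} = (\<lambda>s. mid n (- int s)) ` {..<n}"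
    by (rule periodic_image) simp
  ultimately show ?thesis
    by (simp add: stage_def N2_def fixed_edge_def Let_def lessThan_atLeast0)
qed

text \<open>The network between the two moves of round \<open>t\<close>. The edges at
  \<open>M_{-t}\<close> come first, as the Y-Delta move removes exactly these.\<close>

definition half_stage :: "'f \<Rightarrow> nat \<Rightarrow> (vertex, 'f) network" where
  "half_stage p t =
     \<lparr>boundary = lft n ` {1..int n} \<union> rgt n ` {1..int n},
      interior = (\<lambda>s. new n (- int s)) ` {..<Suc t} \<union> (\<lambda>s. mid n (- int s)) ` {t..<n},
      edges = {#({mid n (- int t), new n (- int t)}, spoke p t),
          ({mid n (- int t), lft n (- int t)}, b (- int t)),
          ({mid n (- int t), rgt n (- int t - 1)}, d (- int t))#}
        + {#({lft n (1 - int t), new n (- int t)}, spoke p t / (c (1 - int t) * resistance p t)),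
            ({new n (- int t), rgt n (- int t)}, spoke p t / (a (1 - int t) * resistance p t))#}
        + {#fixed_edge p#}
        + (\<Sum>s<t. new_star p s) + (\<Sum>s\<in>{Suc t..<n}. star n (mid n) a b c d (- int s))\<rparr>"

text \<open>The star at \<open>M_{-t}\<close> is opened and sorted so that the triangle can be
  subtracted as one multiset.\<close>

lemma stage_edges:
  assumes "t < n"
  shows "edges (stage p t) =
    {#({rgt n (- int t), mid n (- int t)}, c (1 - int t)),
      ({lft n (1 - int t), mid n (- int t)}, a (1 - int t)),
      ({lft n (1 - int t), rgt n (- int t)}, 1 / resistance p t)#}
    + {#({mid n (- int t), lft n (- int t)}, b (- int t)),
        ({mid n (- int t), rgt n (- int t - 1)}, d (- int t))#}
    + {#fixed_edge p#}
    + (\<Sum>s<t. new_star p s) + (\<Sum>s\<in>{Suc t..<n}. star n (mid n) a b c d (- int s))"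
proof -
  have "(\<Sum>s\<in>{t..<n}. star n (mid n) a b c d (- int s)) =
      star n (mid n) a b c d (- int t) + (\<Sum>s\<in>{Suc t..<n}. star n (mid n) a b c d (- int s))"
    using assms by (simp add: sum.atLeast_Suc_lessThan)
  then show ?thesis
    by (simp add: stage_def star_def insert_commute)
qed

text \<open>\<open>A * B + A * C + B * C\<close> equals \<open>spoke p t / resistance p t\<close>.
  The forward direction serves uniqueness of \<open>p\<close>, the backward one the existence of a
  run.\<close>

lemma delta_wye_stage:
  assumes "t < n"
  shows "delta_wye (new n (- int t)) (lft n (1 - int t)) (rgt n (- int t)) (mid n (- int t))
      (c (1 - int t)) (a (1 - int t)) (1 / resistance p t) (stage p t) N \<longleftrightarrow>
    resistance p t \<noteq> 0 \<and> spoke p t \<noteq> 0 \<and> N = half_stage p t"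
\<comment> \<open>At resistance \<open>0\<close> the moving edge has conductance
  \<open>1 / 0 = 0\<close>, which rules the move out: both sides are false.\<close>
proof (cases "resistance p t = 0")
  case False
  define A B C where "A = c (1 - int t)" "B = a (1 - int t)" "C = 1 / resistance p t"
  have S: "A * B + A * C + B * C = spoke p t / resistance p t"
    using False by (simp add: A_B_C_def spoke_def field_simps)
  have S': "spoke p t / resistance p t / C = spoke p t"
      "spoke p t / resistance p t / A = spoke p t / (c (1 - int t) * resistance p t)"
      "spoke p t / resistance p t / B = spoke p t / (a (1 - int t) * resistance p t)"
    using False by (simp_all add: A_B_C_def)
  have new: "new n (- int t) \<notin> boundary (stage p t) \<union> interior (stage p t)"
    using assms by (auto simp: stage_def label_eq_iff)
  have N: "(stage p t)\<lparr>interior := insert (new n (- int t)) (interior (stage p t)),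
       edges := edges (stage p t) - {#({rgt n (- int t), mid n (- int t)}, A),
           ({lft n (1 - int t), mid n (- int t)}, B), ({lft n (1 - int t), rgt n (- int t)}, C)#}
         + {#({new n (- int t), lft n (1 - int t)}, (A * B + A * C + B * C) / A),
             ({new n (- int t), rgt n (- int t)}, (A * B + A * C + B * C) / B),
             ({new n (- int t), mid n (- int t)}, (A * B + A * C + B * C) / C)#}\<rparr> = half_stage p t"
    unfolding S S' stage_edges[OF assms] A_B_C_def(1,2)[symmetric]
    by (simp add: stage_def half_stage_def insert_commute lessThan_Suc A_B_C_def)
  have sub: "{#({rgt n (- int t), mid n (- int t)}, A), ({lft n (1 - int t), mid n (- int t)}, B),
      ({lft n (1 - int t), rgt n (- int t)}, C)#} \<subseteq># edges (stage p t)"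
    unfolding stage_edges[OF assms] A_B_C_def by simp
  have nonzero': "A \<noteq> 0" "B \<noteq> 0" "C \<noteq> 0" "A * B + A * C + B * C \<noteq> 0 \<longleftrightarrow> spoke p t \<noteq> 0"
    unfolding S using False nonzero by (simp_all add: A_B_C_def)
  have "distinct [lft n (1 - int t), rgt n (- int t), mid n (- int t)]"
    by simp
  with new sub nonzero' False show ?thesis
    unfolding delta_wye_def A_B_C_def[symmetric] N by blast
qed (simp add: delta_wye_def)

text \<open>\<open>M_{-t}\<close> has degree 3: finished stars contain no \<open>M\<close>, later
  ones only other \<open>M\<close>.\<close>

lemma filter_half_stage:
  assumes "t < n"
  shows "filter_mset (\<lambda>e. mid n (- int t) \<in> fst e) (edges (half_stage p t)) =
    {#({mid n (- int t), new n (- int t)}, spoke p t),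
      ({mid n (- int t), lft n (- int t)}, b (- int t)),
      ({mid n (- int t), rgt n (- int t - 1)}, d (- int t))#}"
proof -
  have 1: "filter_mset (\<lambda>e. mid n (- int t) \<in> fst e) (\<Sum>s<t. new_star p s) = {#}"
    by (auto simp: filter_mset_eq_mempty_iff set_mset_sum new_star_def)
  have 2: "filter_mset (\<lambda>e. mid n (- int t) \<in> fst e)
      (\<Sum>s\<in>{Suc t..<n}. star n (mid n) a b c d (- int s)) = {#}"
    using assms by (auto simp: filter_mset_eq_mempty_iff set_mset_sum star_def label_eq_iff)
  show ?thesis
    by (simp add: half_stage_def 1 2 fixed_edge_def)
qed

text \<open>The edges at \<open>M_{-t}\<close> lead to vertices of different kinds, which forces
  \<alpha>, \<beta>, \<gamma>; by \<open>spoke_add\<close> their sum is nonzero iff the next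
  resistance is.\<close>

lemma wye_delta_half_stage:
  assumes "t < n" "spoke p t \<noteq> 0"
  shows "wye_delta (mid n (- int t)) (new n (- int t)) (lft n (- int t)) (rgt n (- int t - 1))
      \<alpha> \<beta> \<gamma> (half_stage p t) N \<longleftrightarrow>
    resistance p (Suc t) \<noteq> 0 \<and> \<alpha> = spoke p t \<and> \<beta> = b (- int t) \<and> \<gamma> = d (- int t) \<and>
    N = stage p (Suc t)"
proof (cases "\<alpha> = spoke p t \<and> \<beta> = b (- int t) \<and> \<gamma> = d (- int t)")
  case False
  with False show ?thesis
    unfolding wye_delta_def filter_half_stage[OF assms(1)]
    by (subst tagged_mset_eq_iff) (auto simp: doubleton_eq_iff)
next
  case True
  let ?j = "- int t" and ?X = "resistance p (Suc t)"
  have sum: "\<alpha> + \<beta> + \<gamma> = b ?j * d ?j * ?X"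
    using True spoke_add by simp
  have q: "\<beta> * \<gamma> / (\<alpha> + \<beta> + \<gamma>) = 1 / ?X" "\<alpha> * \<gamma> / (\<alpha> + \<beta> + \<gamma>) = spoke p t / (b ?j * ?X)"
      "\<alpha> * \<beta> / (\<alpha> + \<beta> + \<gamma>) = spoke p t / (d ?j * ?X)"
    unfolding sum using True nonzero by simp_all
  have int: "interior (half_stage p t) - {mid n ?j} = interior (stage p (Suc t))"
  proof -
    have "{t..<n} = insert t {Suc t..<n}"
      using assms by auto
    moreover have "mid n ?j \<notin> (\<lambda>s. mid n (- int s)) ` {Suc t..<n}"
      using assms by (auto simp: label_eq_iff)
    moreover have "mid n ?j \<notin> (\<lambda>s. new n (- int s)) ` {..<Suc t}"
      by auto
    ultimately show ?thesis
      by (simp add: half_stage_def stage_def Un_Diff)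
  qed
  have j: "1 - int (Suc t) = ?j" "- int (Suc t) = ?j - 1"
    by simp_all
  have N: "(half_stage p t)\<lparr>interior := interior (half_stage p t) - {mid n ?j},
       edges := edges (half_stage p t) - {#({mid n ?j, new n ?j}, \<alpha>), ({mid n ?j, lft n ?j}, \<beta>),
           ({mid n ?j, rgt n (?j - 1)}, \<gamma>)#}
         + {#({lft n ?j, rgt n (?j - 1)}, \<beta> * \<gamma> / (\<alpha> + \<beta> + \<gamma>)),
             ({new n ?j, rgt n (?j - 1)}, \<alpha> * \<gamma> / (\<alpha> + \<beta> + \<gamma>)),
             ({new n ?j, lft n ?j}, \<alpha> * \<beta> / (\<alpha> + \<beta> + \<gamma>))#}\<rparr> = stage p (Suc t)"
    unfolding q int using True
    by (simp add: half_stage_def stage_def new_star_def insert_commute j del: of_nat_Suc)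
  have "\<alpha> \<noteq> 0" "\<beta> \<noteq> 0" "\<gamma> \<noteq> 0" "\<alpha> + \<beta> + \<gamma> \<noteq> 0 \<longleftrightarrow> ?X \<noteq> 0"
    unfolding sum using True assms(2) nonzero by simp_all
  moreover have "mid n ?j \<in> interior (half_stage p t)"
    using assms(1) by (simp add: half_stage_def)
  moreover have "distinct [mid n ?j, new n ?j, lft n ?j, rgt n (?j - 1)]"
    by simp
  ultimately show ?thesis
    unfolding wye_delta_def filter_half_stage[OF assms(1)] N using True by blast
qed

text \<open>Both moves determine their result, so a run leaves no choice.\<close>

lemma procedure_stage:
  assumes "procedure n a b c d p t N q"
  shows "N = stage p t \<and> q = 1 / resistance p t"
  using assms
proof induction
  case (start N)
  \<comment> \<open>\<open>1 / (1 / p) = p\<close> holds at \<open>p = 0\<close> too, because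
    \<open>1 / 0 = 0\<close>.\<close>
  then show ?case by (simp add: stage_0 Let_def)
next
  case (round t N q k N' \<alpha> \<beta> \<gamma> N'')
  have k: "k - 1 = - int t" "k - 2 = - int t - 1" "k = 1 - int t"
    using round by auto
  from round have "delta_wye (new n (- int t)) (lft n (1 - int t)) (rgt n (- int t)) (mid n (- int t))
      (c (1 - int t)) (a (1 - int t)) (1 / resistance p t) (stage p t) N'"
    using k by simp
  then have N': "spoke p t \<noteq> 0" "N' = half_stage p t"
    using delta_wye_stage[OF round(2)] by auto
  from round(5) N'(2) have "wye_delta (mid n (- int t)) (new n (- int t)) (lft n (- int t)) (rgt n (- int t - 1))
      \<alpha> \<beta> \<gamma> (half_stage p t) N''"
    by (simp only: k(1,2))
  then have *: "\<alpha> = spoke p t \<and> \<beta> = b (- int t) \<and> \<gamma> = d (- int t) \<and> N'' = stage p (Suc t)"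
    using wye_delta_half_stage[OF round(2) N'(1)] by simp
  then have "\<alpha> + \<beta> + \<gamma> = b (- int t) * d (- int t) * resistance p (Suc t)"
    using spoke_add by simp
  with * nonzero show ?case
    by simp
qed

text \<open>Round \<open>s\<close> needs \<open>resistance p s\<close> and \<open>spoke p s\<close>
  for its first move and \<open>resistance p (Suc s)\<close> for its second, whence the
  bounds.\<close>

lemma procedure_exists:
  assumes "t \<le> n" "\<And>s. s \<le> t \<Longrightarrow> resistance p s \<noteq> 0" "\<And>s. s < t \<Longrightarrow> spoke p s \<noteq> 0"
  shows "procedure n a b c d p t (stage p t) (1 / resistance p t)"
  using assms
proof (induction t)
  case 0
  show ?case
    using procedure.start[OF refl, of n a b c d p] by (simp add: stage_0 Let_def)
next
  case (Suc t)
  then have "procedure n a b c d p t (stage p t) (1 / resistance p t)"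
    by simp
  moreover have "delta_wye (new n (- int t)) (lft n (1 - int t)) (rgt n (- int t)) (mid n (- int t))
      (c (1 - int t)) (a (1 - int t)) (1 / resistance p t) (stage p t) (half_stage p t)"
    using Suc.prems by (subst delta_wye_stage) auto
  moreover have "wye_delta (mid n (- int t)) (new n (- int t)) (lft n (- int t)) (rgt n (- int t - 1))
      (spoke p t) (b (- int t)) (d (- int t)) (half_stage p t) (stage p (Suc t))"
    using Suc.prems by (subst wye_delta_half_stage) (auto)
  moreover have j: "1 - int t - 1 = - int t" "1 - int t - 2 = - int t - 1"
    by simp_all
  ultimately have "procedure n a b c d p (Suc t) (stage p (Suc t))
      (b (- int t) * d (- int t) / (spoke p t + b (- int t) + d (- int t)))"
    using Suc.prems(1) by (intro procedure.round[OF _ _ refl]) (simp_all add: j)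
  then show ?case
    using nonzero by (simp add: spoke_add)
qed


subsection \<open>The fixed point\<close>

abbreviation "\<tau> \<equiv> tau n a b c d"
abbreviation "\<kappa> \<equiv> kappa n a b c d"

definition gap :: 'f where
  "gap = (\<Prod>k\<in>{1..int n}. b k * d k) - (\<Prod>k\<in>{1..int n}. a k * c k)"

section \<open>Identities between tau and kappa\<close>

lemma tau_periodic: "\<tau> (k + int n) = \<tau> k" and kappa_periodic: "\<kappa> (k + int n) = \<kappa> k"
  by (intro tau_shift kappa_shift periodic)+

lemma window:
  "(\<Prod>k\<in>{i..i + int n - 1}. a k * c k) = (\<Prod>k\<in>{1..int n}. a k * c k)"
  "(\<Prod>k\<in>{i..i + int n - 1}. b k * d k) = (\<Prod>k\<in>{1..int n}. b k * d k)"
proof -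
  have int: "{i..i + int n - 1} = {i..<i + int n}" "{1..int n} = {1..<1 + int n}"
    by auto
  show "(\<Prod>k\<in>{i..i + int n - 1}. a k * c k) = (\<Prod>k\<in>{1..int n}. a k * c k)"
    "(\<Prod>k\<in>{i..i + int n - 1}. b k * d k) = (\<Prod>k\<in>{1..int n}. b k * d k)"
    unfolding int by (intro prod.periodic_window; simp add: periodic)+
qed

text \<open>For \<open>j \<ge> 1\<close> the summands of \<open>\<tau> i\<close> are
  \<open>a i * c i\<close> times those of \<open>\<kappa> i\<close>. Of the boundary terms, those
  with \<open>b i + d i\<close> cancel and those with \<open>a i + c i\<close> leave the two full
  products in \<open>gap\<close>.\<close>

lemma tau_eq_kappa: "\<tau> i = a i * c i * \<kappa> i + gap * (a i + c i)"
proof -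
  let ?A = "\<lambda>k. a k * c k" and ?B = "\<lambda>k. b k * d k"
  let ?f = "\<lambda>j. (a (i + j) + c (i + j)) * prod ?A {i..i + j - 1} * prod ?B {i + j..i + int n - 1}
      + (b (i + j) + d (i + j)) * prod ?A {i..i + j} * prod ?B {i + j + 1..i + int n - 1}"
  let ?g = "\<lambda>j. (a (i + j) + c (i + j)) * prod ?A {i + 1..i + j - 1} * prod ?B {i + j..i + int n - 1}
      + (b (i + j) + d (i + j)) * prod ?A {i + 1..i + j} * prod ?B {i + j + 1..i + int n - 1}"
  have "{0..int n - 1} = insert 0 {1..int n - 1}"
    using n by auto
  then have "\<tau> i = ?f 0 + (\<Sum>j\<in>{1..int n - 1}. ?f j)"
    by (simp add: tau_def)
  also have "(\<Sum>j\<in>{1..int n - 1}. ?f j) = ?A i * (\<Sum>j\<in>{1..int n - 1}. ?g j)"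
    unfolding sum_distrib_left
  proof (intro sum.cong refl)
    fix j assume "j \<in> {1..int n - 1}"
    then have "{i..i + j - 1} = insert i {i + 1..i + j - 1}" "{i..i + j} = insert i {i + 1..i + j}"
      by auto
    then show "?f j = ?A i * ?g j"
      by (simp add: algebra_simps)
  qed
  also have "(\<Sum>j\<in>{1..int n - 1}. ?g j) =
      \<kappa> i - (a i + c i) * prod ?A {i + 1..i + int n - 1} - (b i + d i) * prod ?B {i + 1..i + int n - 1}"
    by (simp add: kappa_def)
  also have "?f 0 = (a i + c i) * prod ?B {1..int n} + (b i + d i) * ?A i * prod ?B {i + 1..i + int n - 1}"
    by (simp add: window)
  finally have *: "\<tau> i = (a i + c i) * prod ?B {1..int n} + ?A i * \<kappa> i
      - (a i + c i) * (?A i * prod ?A {i + 1..i + int n - 1})"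
    by (simp add: algebra_simps)
  have "{i..i + int n - 1} = insert i {i + 1..i + int n - 1}"
    using n by auto
  then have "?A i * prod ?A {i + 1..i + int n - 1} = prod ?A {1..int n}"
    by (simp flip: window(1)[of i])
  then show ?thesis
    unfolding * by (simp add: gap_def algebra_simps)
qed

text \<open>Mirror image: now the windows end at \<open>i + int n\<close>, so the factor
  \<open>b i * d i\<close> splits off at the upper end, and \<open>j = n\<close> is the exceptional
  summand.\<close>

lemma tau_Suc_eq_kappa: "\<tau> (i + 1) + gap * (b i + d i) = b i * d i * \<kappa> i"
proof -
  let ?A = "\<lambda>k. a k * c k" and ?B = "\<lambda>k. b k * d k"
  let ?f = "\<lambda>j. (a (i + j) + c (i + j)) * prod ?A {i + 1..i + j - 1} * prod ?B {i + j..i + int n}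
      + (b (i + j) + d (i + j)) * prod ?A {i + 1..i + j} * prod ?B {i + j + 1..i + int n}"
  let ?g = "\<lambda>j. (a (i + j) + c (i + j)) * prod ?A {i + 1..i + j - 1} * prod ?B {i + j..i + int n - 1}
      + (b (i + j) + d (i + j)) * prod ?A {i + 1..i + j} * prod ?B {i + j + 1..i + int n - 1}"
  have "\<tau> (i + 1) = (\<Sum>j\<in>{1..int n}. ?f j)"
    unfolding tau_def
    by (rule sum.reindex_bij_witness[of _ "\<lambda>j. j - 1" "\<lambda>j. j + 1"]) (auto simp: algebra_simps)
  also have "{1..int n} = insert (int n) {1..int n - 1}"
    using n by auto
  then have "(\<Sum>j\<in>{1..int n}. ?f j) = ?f (int n) + (\<Sum>j\<in>{1..int n - 1}. ?f j)"
    by simp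
  also have "(\<Sum>j\<in>{1..int n - 1}. ?f j) = ?B i * (\<Sum>j\<in>{1..int n - 1}. ?g j)"
    unfolding sum_distrib_left
  proof (intro sum.cong refl)
    fix j assume "j \<in> {1..int n - 1}"
    then have "{i + j..i + int n} = insert (i + int n) {i + j..i + int n - 1}"
      "{i + j + 1..i + int n} = insert (i + int n) {i + j + 1..i + int n - 1}"
      by auto
    then show "?f j = ?B i * ?g j"
      by (simp add: periodic algebra_simps)
  qed
  also have "(\<Sum>j\<in>{1..int n - 1}. ?g j) =
      \<kappa> i - (a i + c i) * prod ?A {i + 1..i + int n - 1} - (b i + d i) * prod ?B {i + 1..i + int n - 1}"
    by (simp add: kappa_def)
  also have "?f (int n) = (a i + c i) * prod ?A {i + 1..i + int n - 1} * ?B i + (b i + d i) * prod ?A {1..int n}"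
    using window(1)[of "i + 1"] by (simp add: periodic)
  finally have *: "\<tau> (i + 1) = (b i + d i) * prod ?A {1..int n} + ?B i * \<kappa> i
      - (b i + d i) * (?B i * prod ?B {i + 1..i + int n - 1})"
    by (simp add: algebra_simps)
  have "{i..i + int n - 1} = insert i {i + 1..i + int n - 1}"
    using n by auto
  then have "?B i * prod ?B {i + 1..i + int n - 1} = prod ?B {1..int n}"
    by (simp flip: window(2)[of i])
  then show ?thesis
    unfolding * by (simp add: gap_def algebra_simps)
qed

text \<open>Two orbits of the same affine maps differ by the product of the slopes, here cleared of
  denominators.\<close>

lemma resistance_diff:
  "(resistance p t - resistance p' t) * (\<Prod>s<t. b (- int s) * d (- int s)) =
    (1 / p - 1 / p') * (\<Prod>s<t. a (1 - int s) * c (1 - int s))"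
proof (induction t)
  case (Suc t)
  let ?A = "a (1 - int t) * c (1 - int t)" and ?B = "b (- int t) * d (- int t)"
  have "(resistance p (Suc t) - resistance p' (Suc t)) * ?B = ?A * (resistance p t - resistance p' t)"
    using nonzero by (simp add: resistance.simps field_simps)
  then have "(resistance p (Suc t) - resistance p' (Suc t)) * (\<Prod>s<Suc t. b (- int s) * d (- int s)) =
      ?A * ((resistance p t - resistance p' t) * (\<Prod>s<t. b (- int s) * d (- int s)))"
    by (simp add: mult_ac)
  then show ?case
    unfolding Suc.IH by (simp add: mult_ac)
qed simp

lemma prod_rounds:
  "(\<Prod>s<n. a (1 - int s) * c (1 - int s)) = (\<Prod>k\<in>{1..int n}. a k * c k)"
  "(\<Prod>s<n. b (- int s) * d (- int s)) = (\<Prod>k\<in>{1..int n}. b k * d k)"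
proof -
  have "(\<Prod>s<n. a (1 - int s) * c (1 - int s)) = (\<Prod>k\<in>{2 - int n..2 - int n + int n - 1}. a k * c k)"
    by (rule prod.reindex_bij_witness[of _ "\<lambda>k. nat (1 - k)" "\<lambda>s. 1 - int s"]) auto
  then show "(\<Prod>s<n. a (1 - int s) * c (1 - int s)) = (\<Prod>k\<in>{1..int n}. a k * c k)"
    by (simp only: window)
  have "(\<Prod>s<n. b (- int s) * d (- int s)) = (\<Prod>k\<in>{1 - int n..1 - int n + int n - 1}. b k * d k)"
    by (rule prod.reindex_bij_witness[of _ "\<lambda>k. nat (- k)" "\<lambda>s. - int s"]) auto
  then show "(\<Prod>s<n. b (- int s) * d (- int s)) = (\<Prod>k\<in>{1..int n}. b k * d k)"
    by (simp only: window)
qed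

end

text \<open>\<open>gap\<close> makes the fixed point unique. On its orbit spokes and resistances are
  values of \<tau> and \<kappa> over \<open>gap\<close>, so the other two conditions make all moves
  applicable.\<close>

locale generic_conductances = periodic_conductances +
  assumes gap_nonzero: "gap \<noteq> 0"
    and tau_nonzero: "\<And>k. \<tau> k \<noteq> 0"
    and kappa_nonzero: "\<And>k. \<kappa> k \<noteq> 0"
begin

text \<open>With \<open>k = 1 - t\<close>, the first identity turns \<open>\<kappa> k\<close> into
  \<open>\<tau> k\<close>, the second turns \<open>\<tau> k\<close> into
  \<open>\<kappa> (k - 1)\<close>; together they make up one round.\<close>

lemma resistance_fixed: "resistance (gap / \<kappa> 1) t = \<kappa> (1 - int t) / gap"
proof (induction t)
  case (Suc t)
  have "a (1 - int t) * c (1 - int t) * resistance (gap / \<kappa> 1) t + (a (1 - int t) + c (1 - int t))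
      + (b (- int t) + d (- int t)) =
    (a (1 - int t) * c (1 - int t) * \<kappa> (1 - int t) + gap * (a (1 - int t) + c (1 - int t))
      + gap * (b (- int t) + d (- int t))) / gap"
    unfolding Suc using gap_nonzero by (simp add: field_simps)
  also have "\<dots> = b (- int t) * d (- int t) * \<kappa> (- int t) / gap"
    using tau_Suc_eq_kappa[of "- int t"] by (simp flip: tau_eq_kappa)
  finally show ?case
    using nonzero by (simp add: resistance.simps)
qed (simp add: gap_nonzero)

lemma resistance_fixed_round: "resistance (gap / \<kappa> 1) n = \<kappa> 1 / gap"
  using kappa_periodic[of "1 - int n"] unfolding resistance_fixed by simp

lemma spoke_fixed: "spoke (gap / \<kappa> 1) t = \<tau> (1 - int t) / gap"
  using gap_nonzero by (simp add: spoke_def resistance_fixed tau_eq_kappa[of "1 - int t"] field_simps)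

lemma procedure_fixed_iff:
  "p \<noteq> 0 \<and> procedure n a b c d p n N p \<longleftrightarrow> p = gap / \<kappa> 1 \<and> N = stage p n"
proof
  assume p: "p \<noteq> 0 \<and> procedure n a b c d p n N p"
  let ?p = "gap / \<kappa> 1"
  have "resistance ?p n = 1 / ?p"
    by (simp add: resistance_fixed_round)
  moreover have "N = stage p n" "p = 1 / resistance p n"
    using procedure_stage p by auto
  then have "resistance p n = 1 / p"
    by (metis div_by_1 divide_divide_eq_right mult_1)
  \<comment> \<open>Both orbits return to their start, so their difference is the same before and
    after the \<open>n\<close> rounds.\<close>
  ultimately have "(1 / p - 1 / ?p) * (\<Prod>k\<in>{1..int n}. b k * d k) =
      (1 / p - 1 / ?p) * (\<Prod>k\<in>{1..int n}. a k * c k)"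
    using resistance_diff[of p n ?p] unfolding prod_rounds by metis
  then have "(1 / p - 1 / ?p) * gap = 0"
    unfolding gap_def right_diff_distrib by simp
  then have "1 / p = 1 / ?p"
    using gap_nonzero by simp
  with \<open>N = stage p n\<close> p show "p = ?p \<and> N = stage p n"
    by (metis div_by_1 divide_divide_eq_right mult_1)
next
  assume p: "p = gap / \<kappa> 1 \<and> N = stage p n"
  then have "resistance p s \<noteq> 0" "spoke p s \<noteq> 0" for s
    using gap_nonzero tau_nonzero kappa_nonzero by (simp_all add: resistance_fixed spoke_fixed)
  with p have "procedure n a b c d p n N (1 / resistance p n)"
    using procedure_exists[of n p] by simp
  moreover have "1 / resistance p n = p"
    using p by (simp add: resistance_fixed_round)
  ultimately show "p \<noteq> 0 \<and> procedure n a b c d p n N p"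
    using p gap_nonzero kappa_nonzero by simp
qed

text \<open>The first two conductance slots of \<open>N2\<close> are edges at left vertices. These
  now carry \<open>c'\<close> and \<open>d'\<close>, hence the order of arguments;
  \<open>gap\<close> cancels from every quotient.\<close>

lemma stage_fixed:
  fixes a' b' c' d' :: "int \<Rightarrow> 'a" and p :: 'a
  defines "a' \<equiv> \<lambda>k. \<tau> k / (a k * \<kappa> k)"
    and "b' \<equiv> \<lambda>k. \<tau> (k + 1) / (b k * \<kappa> k)"
    and "c' \<equiv> \<lambda>k. \<tau> k / (c k * \<kappa> k)"
    and "d' \<equiv> \<lambda>k. \<tau> (k + 1) / (d k * \<kappa> k)"
    and "p \<equiv> gap / \<kappa> 1"
    and "N \<equiv> N2 n (new n) c' d' a' b'"
  shows "stage p n =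
    N\<lparr>edges := edges N + {#({lft n 1, rgt n (int n)}, p), ({lft n 1, rgt n (int n)}, - p)#}\<rparr>"
proof -
  have tau1: "\<tau> (k + int n + 1) = \<tau> (k + 1)" for k
    using tau_periodic[of "k + 1"] by (simp add: add_ac)
  have "edges N = (\<Sum>s<n. star n (new n) c' d' a' b' (- int s))"
    unfolding N_def by (rule N2_edges_stars)
      (simp_all add: a'_def b'_def c'_def d'_def tau_periodic tau1 kappa_periodic periodic)
  moreover have "new_star p s = star n (new n) c' d' a' b' (- int s)" for s
  proof -
    have 1: "resistance p (Suc s) = \<kappa> (- int s) / gap" "resistance p s = \<kappa> (1 - int s) / gap"
      unfolding p_def resistance_fixed by simp_all
    show ?thesis
      unfolding new_star_def 1 unfolding p_def spoke_fixed star_def a'_def b'_def c'_def d'_def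
      using gap_nonzero by (simp add: add.commute)
  qed
  moreover have "1 / resistance p n = p"
    by (simp add: p_def resistance_fixed_round)
  \<comment> \<open>The last edge \<open>e_n\<close> joins \<open>1 - n\<close> and
    \<open>(-n)'\<close>, which are again \<open>1\<close> and \<open>n'\<close>.\<close>
  moreover have "lft n (1 - int n) = lft n 1" "rgt n (- int n) = rgt n (int n)"
    using shift_labels(1)[of n "1 - int n"] shift_labels(2)[of n "- int n"] shift_labels(2)[of n 0]
    by simp_all
  ultimately have "edges (stage p n) =
      edges N + {#({lft n 1, rgt n (int n)}, p), ({lft n 1, rgt n (int n)}, - p)#}"
    by (simp add: stage_def fixed_edge_def)
  moreover have "new n ` {1..int n} = (\<lambda>s. new n (- int s)) ` {..<n}"
    by (rule periodic_image) simp
  then have "boundary (stage p n) = boundary N" "interior (stage p n) = interior N"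
    by (simp_all add: stage_def N_def N2_def)
  ultimately show ?thesis
    by (intro network.equality) simp_all
qed

end

section \<open>The theorem for indeterminate conductances\<close>

theorem theorem4p3:
  fixes n :: nat and a b c d a' b' c' d' :: "int \<Rightarrow> 'k::field ratfun"
  assumes n: "n \<ge> 1"
    and a: "a = cond_a n" and b: "b = cond_b n" and c: "c = cond_c n" and d: "d = cond_d n"
    and a': "a' = (\<lambda>k. tau n a b c d k / (a k * kappa n a b c d k))"
    and b': "b' = (\<lambda>k. tau n a b c d (k + 1) / (b k * kappa n a b c d k))"
    and c': "c' = (\<lambda>k. tau n a b c d k / (c k * kappa n a b c d k))"
    and d': "d' = (\<lambda>k. tau n a b c d (k + 1) / (d k * kappa n a b c d k))"
  shows "(\<exists>!p. p \<noteq> 0 \<and> (\<exists>N. procedure n a b c d p n N p)) \<and>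
    (\<forall>p N. p \<noteq> 0 \<and> procedure n a b c d p n N p \<longrightarrow>
       (let del = {#({lft n 1, rgt n (int n)}, p), ({lft n 1, rgt n (int n)}, - p)#}
        in del \<subseteq># edges N \<and>
           N\<lparr>edges := edges N - del\<rparr> = N2 n (new n) c' d' a' b'))"
proof -
  have shift: "indet_family n r (k + int n) = indet_family n r k" for r k
    by (simp add: indet_family_def)
  interpret periodic_conductances n a b c d
    unfolding a b c d
    by standard (use n in \<open>simp_all only: cond_a_def cond_b_def cond_c_def cond_d_def shift
      cond_nonzero[unfolded cond_a_def cond_b_def cond_c_def cond_d_def] not_False_eq_True\<close>)
  interpret generic_conductances n a b c d
  proof
    show "gap \<noteq> 0"
      unfolding gap_def unfolding a b c d using n by (rule prod_cond_neq)
    show "\<tau> k \<noteq> 0" "\<kappa> k \<noteq> 0" for k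
      unfolding a b c d using n by (rule tau_cond_nonzero kappa_cond_nonzero)+
  qed
  have iff: "p \<noteq> 0 \<and> procedure n a b c d p n N p \<longleftrightarrow> p = gap / \<kappa> 1 \<and> N = stage p n" for p N
    by (rule procedure_fixed_iff)
  show ?thesis
  proof (intro conjI allI impI)
    show "\<exists>!p. p \<noteq> 0 \<and> (\<exists>N. procedure n a b c d p n N p)"
    proof (rule ex1I)
      show "gap / \<kappa> 1 \<noteq> 0 \<and> (\<exists>N. procedure n a b c d (gap / \<kappa> 1) n N (gap / \<kappa> 1))"
        using iff[of "gap / \<kappa> 1" "stage (gap / \<kappa> 1) n"] by (simp only: simp_thms) blast
    next
      fix p
      assume "p \<noteq> 0 \<and> (\<exists>N. procedure n a b c d p n N p)"
      then obtain N where "p \<noteq> 0 \<and> procedure n a b c d p n N p"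
        by (elim conjE exE) (rule that, rule conjI)
      then show "p = gap / \<kappa> 1"
        unfolding iff by (rule conjunct1)
    qed
  next
    fix p N
    assume "p \<noteq> 0 \<and> procedure n a b c d p n N p"
    then have p: "p = gap / \<kappa> 1" and "N = stage p n"
      unfolding iff by (rule conjunct1, rule conjunct2)
    \<comment> \<open>Once the two added edges cancel, only this trivial update remains.\<close>
    have "N\<lparr>edges := edges N\<rparr> = N" for N :: "(vertex, 'k ratfun) network"
      by (cases N) simp
    then show "let del = {#({lft n 1, rgt n (int n)}, p), ({lft n 1, rgt n (int n)}, - p)#}
        in del \<subseteq># edges N \<and> N\<lparr>edges := edges N - del\<rparr> = N2 n (new n) c' d' a' b'"
      using stage_fixed[folded a' b' c' d' p] \<open>N = stage p n\<close>
      by (simp add: Let_def)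
  qed
qed

end
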